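(* Let $\mathcal{C}$ be a congruence-modular equational class, let $M,N$ be members of $\mathcal{C}$ and let $h:M\to N$ be a morphism in $\mathcal{C}$. Then: (1) if $\mathcal{C}$ is semi-degenerate, $\mathrm{Spec}(M)=\mathrm{Max}(M)$ and $\mathrm{Spec}(N)=\mathrm{Con}_2(N)$, then $h$ is admissible and fulfills GU; (2) if $\mathcal{C}$ is semi-degenerate, the commutator in $M$ equals the intersection of congruences, $\mathrm{Con}(M)$ is a Boolean algebra and $\mathrm{Spec}(N)=\mathrm{Con}_2(N)$, then $h$ is admissible and fulfills GU; (3) if $\mathcal{C}$ is semi-degenerate and congruence-distributive, $\mathrm{Con}(M)$ is a Boolean algebra and $\mathrm{Spec}(N)=\mathrm{Con}_2(N)$, then $h$ is admissible and fulfills GU; (4) if $(h^* )^{-1}(\{\nabla_M\})=\{\nabla_N\}$, $\mathrm{Spec}(M)=\mathrm{Max}(M)$ and $\mathrm{Spec}(N)=\mathrm{Con}_2(N)$, then $h$ is admissible and fulfills GU; (5) if $(h^* )^{-1}(\{\nabla_M\})=\{\nabla_N\}$, the commutator in $M$ equals the intersection, $\mathrm{Con}(M)$ is a Boolean algebra and $\mathrm{Spec}(N)=\mathrm{Con}_2(N)$, then $h$ is admissible and fulfills GU; (6) if $(h^* )^{-1}(\{\nabla_M\})=\{\nabla_N\}$, $\mathcal{C}$ is congruence-distributive, $\mathrm{Con}(M)$ is a Boolean algebra and $\mathrm{Spec}(N)=\mathrm{Con}_2(N)$, then $h$ is admissible and fulfills GU.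
   Context: An equational class (variety) $\mathcal{C}$ of algebras of a fixed type is congruence-modular (respectively congruence-distributive) if the congruence lattice $\mathrm{Con}(M)$ is modular (respectively distributive) for every member $M$ of $\mathcal{C}$; it is semi-degenerate if no non-trivial algebra in $\mathcal{C}$ has a one-element subalgebra. All algebras are non-empty; a morphism in $\mathcal{C}$ is a homomorphism between members of $\mathcal{C}$. For an algebra $M$, $\Delta_M$ is the equality relation and $\nabla_M=M^2$; $\mathrm{Max}(M)$ is the set of maximal elements of $\mathrm{Con}(M)\setminus\{\nabla_M\}$ with respect to inclusion; $\mathrm{Con}_2(M)=\{\theta\in\mathrm{Con}(M) : |M/\theta|=2\}$. In a congruence-modular class, the commutator $[\alpha,\beta]_M$ of $\alpha,\beta\in\mathrm{Con}(M)$ is the (Freese--McKenzie) modular commutator, i.e. the smallest congruence $\delta$ of $M$ such that, for every term $t(\bar x,\bar y)$ and all tuples $\bar a,\bar b,\bar c,\bar d$ of elements of $M$ with $(a_i,b_i)\in\alpha$ for all $i$ and $(c_j,d_j)\in\beta$ for all $j$, $(t(\bar a,\bar c),t(\bar a,\bar d))\in\delta$ implies $(t(\bar b,\bar c),t(\bar b,\bar d))\in\delta$; in congruence-distributive classes it equals $\alpha\cap\beta$. A congruence $\phi\neq\nabla_M$ is prime if, for all $\alpha,\beta\in\mathrm{Con}(M)$, $[\alpha,\beta]_M\subseteq\phi$ implies $\alpha\subseteq\phi$ or $\beta\subseteq\phi$; $\mathrm{Spec}(M)$ is the set of prime congruences of $M$. For a morphism $f:A\to B$, $f^*:\mathrm{Con}(B)\to\mathrm{Con}(A)$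 is given by $f^*(\psi)=\{(x,y)\in A^2 : (f(x),f(y))\in\psi\}$. $f$ is admissible if $f^*(\psi)\in\mathrm{Spec}(A)$ for all $\psi\in\mathrm{Spec}(B)$. An admissible morphism $f:A\to B$ fulfills GU (Going Up) if for all $\phi,\psi\in\mathrm{Spec}(A)$ and $\phi_1\in\mathrm{Spec}(B)$ with $\phi\subseteq\psi$ and $f^*(\phi_1)=\phi$ there is $\psi_1\in\mathrm{Spec}(B)$ with $\phi_1\subseteq\psi_1$ and $f^*(\psi_1)=\psi$. *)

theory Defs
  imports Main "HOL-Library.FuncSet"
begin

section \<open>Algebras and terms\<close>

text \<open>
  A type of algebras is an arity function on a HOL type of finitary operation symbols. Operations
  take argument lists; their values outside the carrier or at lists of the wrong length are
  irrelevant and never used.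
\<close>

record ('f, 'u) algebra =
  carrier :: "'u set"
  interp :: "'f \<Rightarrow> 'u list \<Rightarrow> 'u"

definition is_algebra :: "('f \<Rightarrow> nat) \<Rightarrow> ('f, 'u) algebra \<Rightarrow> bool" where
  "is_algebra ar A \<longleftrightarrow> carrier A \<noteq> {} \<and>
     (\<forall>f xs. set xs \<subseteq> carrier A \<and> length xs = ar f \<longrightarrow> interp A f xs \<in> carrier A)"

definition subalgebra :: "('f \<Rightarrow> nat) \<Rightarrow> 'u set \<Rightarrow> ('f, 'u) algebra \<Rightarrow> bool" where
  "subalgebra ar S A \<longleftrightarrow> S \<subseteq> carrier A \<and> S \<noteq> {} \<and>
     (\<forall>f xs. set xs \<subseteq> S \<and> length xs = ar f \<longrightarrow> interp A f xs \<in> S)"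

definition morphism ::
    "('f \<Rightarrow> nat) \<Rightarrow> ('f, 'u) algebra \<Rightarrow> ('f, 'v) algebra \<Rightarrow> ('u \<Rightarrow> 'v) \<Rightarrow> bool" where
  "morphism ar A B h \<longleftrightarrow> h \<in> carrier A \<rightarrow> carrier B \<and>
     (\<forall>f xs. set xs \<subseteq> carrier A \<and> length xs = ar f \<longrightarrow>
        h (interp A f xs) = interp B f (map h xs))"

datatype ('f, 'v) trm = Var 'v | App 'f "('f, 'v) trm list"

fun wf_trm :: "('f \<Rightarrow> nat) \<Rightarrow> ('f, 'v) trm \<Rightarrow> bool" where
  "wf_trm ar (Var x) = True"
| "wf_trm ar (App f ts) = (length ts = ar f \<and> (\<forall>t\<in>set ts. wf_trm ar t))"

fun eval_trm :: "('f, 'u) algebra \<Rightarrow> ('v \<Rightarrow> 'u) \<Rightarrow> ('f, 'v) trm \<Rightarrow> 'u" where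
  "eval_trm A v (Var x) = v x"
| "eval_trm A v (App f ts) = interp A f (map (eval_trm A v) ts)"

section \<open>Congruences\<close>

definition Con :: "('f \<Rightarrow> nat) \<Rightarrow> ('f, 'u) algebra \<Rightarrow> ('u \<times> 'u) set set" where
  "Con ar A = {\<theta>. equiv (carrier A) \<theta> \<and>
     (\<forall>f xs ys. length xs = ar f \<and> list_all2 (\<lambda>x y. (x, y) \<in> \<theta>) xs ys \<longrightarrow>
        (interp A f xs, interp A f ys) \<in> \<theta>)}"

definition Delta :: "('f, 'u) algebra \<Rightarrow> ('u \<times> 'u) set" where
  "Delta A = Id_on (carrier A)"

definition Nabla :: "('f, 'u) algebra \<Rightarrow> ('u \<times> 'u) set" where
  "Nabla A = carrier A \<times> carrier A"

text \<open>The congruence generated by a relation; it yields the joins of the lattice of congruences,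
  whose meets are intersections.\<close>

definition Cg :: "('f \<Rightarrow> nat) \<Rightarrow> ('f, 'u) algebra \<Rightarrow> ('u \<times> 'u) set \<Rightarrow> ('u \<times> 'u) set" where
  "Cg ar A R = \<Inter>{\<theta> \<in> Con ar A. R \<subseteq> \<theta>}"

definition cjoin ::
    "('f \<Rightarrow> nat) \<Rightarrow> ('f, 'u) algebra \<Rightarrow> ('u \<times> 'u) set \<Rightarrow> ('u \<times> 'u) set \<Rightarrow> ('u \<times> 'u) set" where
  "cjoin ar A \<alpha> \<beta> = Cg ar A (\<alpha> \<union> \<beta>)"

definition Con_modular :: "('f \<Rightarrow> nat) \<Rightarrow> ('f, 'u) algebra \<Rightarrow> bool" where
  "Con_modular ar A \<longleftrightarrow> (\<forall>\<alpha>\<in>Con ar A. \<forall>\<beta>\<in>Con ar A. \<forall>\<gamma>\<in>Con ar A.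
     \<alpha> \<subseteq> \<gamma> \<longrightarrow> cjoin ar A \<alpha> (\<beta> \<inter> \<gamma>) = cjoin ar A \<alpha> \<beta> \<inter> \<gamma>)"

definition Con_distributive :: "('f \<Rightarrow> nat) \<Rightarrow> ('f, 'u) algebra \<Rightarrow> bool" where
  "Con_distributive ar A \<longleftrightarrow> (\<forall>\<alpha>\<in>Con ar A. \<forall>\<beta>\<in>Con ar A. \<forall>\<gamma>\<in>Con ar A.
     \<alpha> \<inter> cjoin ar A \<beta> \<gamma> = cjoin ar A (\<alpha> \<inter> \<beta>) (\<alpha> \<inter> \<gamma>))"

definition Con_Boolean :: "('f \<Rightarrow> nat) \<Rightarrow> ('f, 'u) algebra \<Rightarrow> bool" where
  "Con_Boolean ar A \<longleftrightarrow> Con_distributive ar A \<and>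
     (\<forall>\<alpha>\<in>Con ar A. \<exists>\<beta>\<in>Con ar A. \<alpha> \<inter> \<beta> = Delta A \<and> cjoin ar A \<alpha> \<beta> = Nabla A)"

definition Max_Con :: "('f \<Rightarrow> nat) \<Rightarrow> ('f, 'u) algebra \<Rightarrow> ('u \<times> 'u) set set" where
  "Max_Con ar A = {\<mu> \<in> Con ar A - {Nabla A}. \<forall>\<theta>\<in>Con ar A - {Nabla A}. \<mu> \<subseteq> \<theta> \<longrightarrow> \<theta> = \<mu>}"

definition Con2 :: "('f \<Rightarrow> nat) \<Rightarrow> ('f, 'u) algebra \<Rightarrow> ('u \<times> 'u) set set" where
  "Con2 ar A = {\<theta> \<in> Con ar A. card (carrier A // \<theta>) = 2}"

section \<open>Commutator and prime congruences\<close>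

text \<open>
  A term \<open>t(x, y)\<close> is a term whose variables are split into the \<open>x i\<close> (left summand) and the
  \<open>y j\<close> (right summand). Tuples are extended to infinite sequences, of which a term only uses
  finitely many entries; as carriers are non-empty, this does not change the condition.
\<close>

definition term_condition ::
    "('f \<Rightarrow> nat) \<Rightarrow> ('f, 'u) algebra \<Rightarrow>
     ('u \<times> 'u) set \<Rightarrow> ('u \<times> 'u) set \<Rightarrow> ('u \<times> 'u) set \<Rightarrow> bool" where
  "term_condition ar A \<alpha> \<beta> \<delta> \<longleftrightarrow>
     (\<forall>t :: ('f, nat + nat) trm. wf_trm ar t \<longrightarrow>
       (\<forall>a b c d. (\<forall>i. (a i, b i) \<in> \<alpha>) \<and> (\<forall>j. (c j, d j) \<in> \<beta>) \<longrightarrow>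
          (eval_trm A (case_sum a c) t, eval_trm A (case_sum a d) t) \<in> \<delta> \<longrightarrow>
          (eval_trm A (case_sum b c) t, eval_trm A (case_sum b d) t) \<in> \<delta>))"

definition commutator ::
    "('f \<Rightarrow> nat) \<Rightarrow> ('f, 'u) algebra \<Rightarrow> ('u \<times> 'u) set \<Rightarrow> ('u \<times> 'u) set \<Rightarrow> ('u \<times> 'u) set" where
  "commutator ar A \<alpha> \<beta> = \<Inter>{\<delta> \<in> Con ar A. term_condition ar A \<alpha> \<beta> \<delta>}"

definition commutator_is_inter :: "('f \<Rightarrow> nat) \<Rightarrow> ('f, 'u) algebra \<Rightarrow> bool" where
  "commutator_is_inter ar A \<longleftrightarrow>
     (\<forall>\<alpha>\<in>Con ar A. \<forall>\<beta>\<in>Con ar A. commutator ar A \<alpha> \<beta> = \<alpha> \<inter> \<beta>)"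

definition Spec :: "('f \<Rightarrow> nat) \<Rightarrow> ('f, 'u) algebra \<Rightarrow> ('u \<times> 'u) set set" where
  "Spec ar A = {\<phi> \<in> Con ar A. \<phi> \<noteq> Nabla A \<and>
     (\<forall>\<alpha>\<in>Con ar A. \<forall>\<beta>\<in>Con ar A. commutator ar A \<alpha> \<beta> \<subseteq> \<phi> \<longrightarrow> \<alpha> \<subseteq> \<phi> \<or> \<beta> \<subseteq> \<phi>)}"

text \<open>The commutator is the least congruence with the term condition, not merely a lower bound.\<close>

lemma Nabla_in_Con:
  assumes "is_algebra ar A"
  shows "Nabla A \<in> Con ar A"
proof -
  have sub: "set xs \<subseteq> carrier A \<and> set ys \<subseteq> carrier A \<and> length ys = length xs"
    if "list_all2 (\<lambda>x y. (x, y) \<in> carrier A \<times> carrier A) xs ys" for xs ys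
    using that by (induction rule: list_all2_induct) auto
  show ?thesis
    using assms sub unfolding Con_def Nabla_def is_algebra_def
    by (auto simp: equiv_def refl_on_def sym_def trans_def)
qed

lemma term_condition_Nabla:
  assumes "is_algebra ar A" and "\<alpha> \<in> Con ar A" and "\<beta> \<in> Con ar A"
  shows "term_condition ar A \<alpha> \<beta> (Nabla A)"
proof -
  have ev: "eval_trm A v t \<in> carrier A"
    if "wf_trm ar t" and "\<And>x. v x \<in> carrier A" for v :: "nat + nat \<Rightarrow> 'b" and t
    using that
  proof (induction t)
    case (Var x)
    then show ?case by simp
  next
    case (App f ts)
    then have "set (map (eval_trm A v) ts) \<subseteq> carrier A"
      by auto
    with App.prems assms(1) show ?case by (simp add: is_algebra_def)
  qed
  have "\<alpha> \<subseteq> carrier A \<times> carrier A" "\<beta> \<subseteq> carrier A \<times> carrier A"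
    using assms(2,3) by (auto simp: Con_def equiv_def)
  then have car: "case_sum b e x \<in> carrier A"
    if "\<forall>i. (a i, b i) \<in> \<alpha>" "\<forall>j. (c j, d j) \<in> \<beta>" "e = c \<or> e = d"
    for a b c d :: "nat \<Rightarrow> 'b" and e x
    using that by (cases x) auto
  show ?thesis
    unfolding term_condition_def Nabla_def using car by (auto intro!: ev)
qed

lemma commutator_least:
  assumes "is_algebra ar A" and "\<alpha> \<in> Con ar A" and "\<beta> \<in> Con ar A"
  shows "commutator ar A \<alpha> \<beta> \<in> Con ar A"
    and "term_condition ar A \<alpha> \<beta> (commutator ar A \<alpha> \<beta>)"
    and "\<delta> \<in> Con ar A \<Longrightarrow> term_condition ar A \<alpha> \<beta> \<delta> \<Longrightarrow> commutator ar A \<alpha> \<beta> \<subseteq> \<delta>"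
proof -
  let ?D = "{\<delta> \<in> Con ar A. term_condition ar A \<alpha> \<beta> \<delta>}"
  have ne: "Nabla A \<in> ?D"
    using Nabla_in_Con term_condition_Nabla assms by blast
  have eqv: "equiv (carrier A) \<delta>" if "\<delta> \<in> ?D" for \<delta>
    using that by (simp add: Con_def)
  have "equiv (carrier A) (\<Inter>?D)"
  proof (rule equivI)
    show "\<Inter>?D \<subseteq> carrier A \<times> carrier A" using ne eqv by (fastforce simp: equiv_def)
    show "refl_on (carrier A) (\<Inter>?D)" using eqv by (fastforce simp: equiv_def refl_on_def)
    show "sym (\<Inter>?D)" using eqv by (fastforce simp: equiv_def sym_def)
    show "trans (\<Inter>?D)" using eqv unfolding equiv_def trans_def by (meson InterE InterI)
  qed
  moreover have "(interp A f xs, interp A f ys) \<in> \<Inter>?D"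
    if "length xs = ar f" "list_all2 (\<lambda>x y. (x, y) \<in> \<Inter>?D) xs ys" for f xs ys
  proof
    fix \<delta> assume d: "\<delta> \<in> ?D"
    have "list_all2 (\<lambda>x y. (x, y) \<in> \<delta>) xs ys"
      by (rule list_all2_mono[OF that(2)]) (use d in blast)
    with d that(1) show "(interp A f xs, interp A f ys) \<in> \<delta>"
      unfolding Con_def by blast
  qed
  ultimately show "commutator ar A \<alpha> \<beta> \<in> Con ar A"
    unfolding commutator_def Con_def[of ar A] by blast
  show "term_condition ar A \<alpha> \<beta> (commutator ar A \<alpha> \<beta>)"
    unfolding commutator_def term_condition_def by blast
  show "\<delta> \<in> Con ar A \<Longrightarrow> term_condition ar A \<alpha> \<beta> \<delta> \<Longrightarrow> commutator ar A \<alpha> \<beta> \<subseteq> \<delta>"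
    unfolding commutator_def by blast
qed

section \<open>Equational classes\<close>

text \<open>
  HOL cannot quantify over types within a formula, so a class of algebras is a set of algebras whose
  carriers are subsets of one type \<open>'u\<close>, which plays the role of the universe. The predicates on
  classes below quantify over the members in this universe. If the type of terms in countably many
  variables injects into \<open>'u\<close>, nothing is lost: failure of modularity or distributivity of some
  \<open>Con A\<close>, or a non-trivial \<open>A\<close> with a one-element subalgebra, is inherited by a finitely generated
  subalgebra of \<open>A\<close>, and every finitely generated algebra has an isomorphic copy in \<open>'u\<close>.
\<close>

definition models ::
    "('f \<Rightarrow> nat) \<Rightarrow> (('f, nat) trm \<times> ('f, nat) trm) set \<Rightarrow> ('f, 'u) algebra set" where
  "models ar E = {A. is_algebra ar A \<and>
     (\<forall>(s, t)\<in>E. \<forall>v. range v \<subseteq> carrier A \<longrightarrow> eval_trm A v s = eval_trm A v t)}"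

definition equational_class :: "('f \<Rightarrow> nat) \<Rightarrow> ('f, 'u) algebra set \<Rightarrow> bool" where
  "equational_class ar C \<longleftrightarrow>
     (\<exists>E. (\<forall>(s, t)\<in>E. wf_trm ar s \<and> wf_trm ar t) \<and> C = models ar E)"

definition congruence_modular :: "('f \<Rightarrow> nat) \<Rightarrow> ('f, 'u) algebra set \<Rightarrow> bool" where
  "congruence_modular ar C \<longleftrightarrow> (\<forall>A\<in>C. Con_modular ar A)"

definition congruence_distributive :: "('f \<Rightarrow> nat) \<Rightarrow> ('f, 'u) algebra set \<Rightarrow> bool" where
  "congruence_distributive ar C \<longleftrightarrow> (\<forall>A\<in>C. Con_distributive ar A)"

definition semi_degenerate :: "('f \<Rightarrow> nat) \<Rightarrow> ('f, 'u) algebra set \<Rightarrow> bool" where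
  "semi_degenerate ar C \<longleftrightarrow>
     (\<forall>A\<in>C. \<not> is_singleton (carrier A) \<longrightarrow> \<not> (\<exists>S. subalgebra ar S A \<and> is_singleton S))"

section \<open>Admissible morphisms and Going Up\<close>

definition pullback :: "('f, 'u) algebra \<Rightarrow> ('u \<Rightarrow> 'v) \<Rightarrow> ('v \<times> 'v) set \<Rightarrow> ('u \<times> 'u) set" where
  "pullback A f \<psi> = {(x, y) \<in> carrier A \<times> carrier A. (f x, f y) \<in> \<psi>}"

definition admissible ::
    "('f \<Rightarrow> nat) \<Rightarrow> ('f, 'u) algebra \<Rightarrow> ('f, 'v) algebra \<Rightarrow> ('u \<Rightarrow> 'v) \<Rightarrow> bool" where
  "admissible ar A B f \<longleftrightarrow> (\<forall>\<psi>\<in>Spec ar B. pullback A f \<psi> \<in> Spec ar A)"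

definition going_up ::
    "('f \<Rightarrow> nat) \<Rightarrow> ('f, 'u) algebra \<Rightarrow> ('f, 'v) algebra \<Rightarrow> ('u \<Rightarrow> 'v) \<Rightarrow> bool" where
  "going_up ar A B f \<longleftrightarrow>
     (\<forall>\<phi>\<in>Spec ar A. \<forall>\<psi>\<in>Spec ar A. \<forall>\<phi>1\<in>Spec ar B. \<phi> \<subseteq> \<psi> \<and> pullback A f \<phi>1 = \<phi> \<longrightarrow>
        (\<exists>\<psi>1\<in>Spec ar B. \<phi>1 \<subseteq> \<psi>1 \<and> pullback A f \<psi>1 = \<psi>))"

end

theory Submission
  imports Defs
begin

text \<open>
  If \<open>|N/\<psi>| = 2\<close>, then \<open>M/h*(\<psi>)\<close> embeds into \<open>N/\<psi>\<close>, so \<open>h*(\<psi>)\<close> is maximal or equal to \<open>\<nabla>\<close>. In the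
  latter case the image of \<open>M\<close> in \<open>N/\<psi>\<close> is a one-element subalgebra of a two-element algebra, which
  semi-degeneracy forbids. As the primes of \<open>M\<close> are its maximal congruences, admissibility follows,
  and Going Up is trivial because maximal congruences form an antichain.

  That the commutator is the intersection under congruence-distributivity can be seen without
  Jonsson terms. Regard \<open>\<beta>\<close> as a subalgebra of \<open>M \<times> M\<close> with projection kernels \<open>\<eta>1\<close>, \<open>\<eta>2\<close>. If \<open>\<delta>\<close>
  satisfies the term condition for \<open>\<alpha>, \<beta>\<close>, then the largest congruence \<open>\<Theta>\<close> of this subalgebra that
  saturates \<open>\<beta> \<inter> \<delta>\<close> relates \<open>(x, x)\<close> and \<open>(y, y)\<close> whenever \<open>x \<alpha> y\<close>. For \<open>(x, y) \<in> \<alpha> \<inter> \<beta>\<close> the path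
  \<open>(x, x) \<Theta> (y, y) \<eta>2 (x, y)\<close> shows that \<open>(x, x)\<close> and \<open>(x, y)\<close> are related by
  \<open>\<eta>1 \<inter> (\<eta>2 \<squnion> \<Theta>) = (\<eta>1 \<inter> \<eta>2) \<squnion> (\<eta>1 \<inter> \<Theta>) \<subseteq> \<Theta>\<close>, hence \<open>(x, y) \<in> \<delta>\<close>.
\<close>

section \<open>Congruences: elimination and introduction rules, intersections and joins\<close>

lemma ConD:
  assumes "\<theta> \<in> Con ar A"
  shows Con_subset: "\<theta> \<subseteq> Nabla A"
    and Con_refl: "\<And>x. x \<in> carrier A \<Longrightarrow> (x, x) \<in> \<theta>"
    and Con_sym: "\<And>x y. (x, y) \<in> \<theta> \<Longrightarrow> (y, x) \<in> \<theta>"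
    and Con_trans: "\<And>x y z. (x, y) \<in> \<theta> \<Longrightarrow> (y, z) \<in> \<theta> \<Longrightarrow> (x, z) \<in> \<theta>"
    and Con_interp: "\<And>f xs ys. length xs = ar f \<Longrightarrow> list_all2 (\<lambda>x y. (x, y) \<in> \<theta>) xs ys \<Longrightarrow>
      (interp A f xs, interp A f ys) \<in> \<theta>"
proof -
  have e: "equiv (carrier A) \<theta>" using assms by (simp add: Con_def)
  show "\<theta> \<subseteq> Nabla A" using e by (auto simp: equiv_def Nabla_def)
  show "\<And>x. x \<in> carrier A \<Longrightarrow> (x, x) \<in> \<theta>" using e by (auto simp: equiv_def refl_on_def)
  show "\<And>x y. (x, y) \<in> \<theta> \<Longrightarrow> (y, x) \<in> \<theta>" using e by (auto simp: equiv_def sym_def)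
  show "\<And>x y z. (x, y) \<in> \<theta> \<Longrightarrow> (y, z) \<in> \<theta> \<Longrightarrow> (x, z) \<in> \<theta>"
    using e unfolding equiv_def trans_def by blast
  show "\<And>f xs ys. length xs = ar f \<Longrightarrow> list_all2 (\<lambda>x y. (x, y) \<in> \<theta>) xs ys \<Longrightarrow>
      (interp A f xs, interp A f ys) \<in> \<theta>"
    using assms by (simp add: Con_def)
qed

lemma ConI:
  assumes "\<theta> \<subseteq> Nabla A"
    and "\<And>x. x \<in> carrier A \<Longrightarrow> (x, x) \<in> \<theta>"
    and "\<And>x y. (x, y) \<in> \<theta> \<Longrightarrow> (y, x) \<in> \<theta>"
    and "\<And>x y z. (x, y) \<in> \<theta> \<Longrightarrow> (y, z) \<in> \<theta> \<Longrightarrow> (x, z) \<in> \<theta>"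
    and "\<And>f xs ys. length xs = ar f \<Longrightarrow> list_all2 (\<lambda>x y. (x, y) \<in> \<theta>) xs ys \<Longrightarrow>
      (interp A f xs, interp A f ys) \<in> \<theta>"
  shows "\<theta> \<in> Con ar A"
proof -
  have "equiv (carrier A) \<theta>"
    using assms(1-3) by (intro equivI refl_onI symI transI) (auto simp: Nabla_def intro: assms(4))
  then show ?thesis using assms(5) by (auto simp: Con_def)
qed

lemma Con_carrier:
  assumes "\<theta> \<in> Con ar A" and "(x, y) \<in> \<theta>"
  shows "x \<in> carrier A" and "y \<in> carrier A"
  using Con_subset[OF assms(1)] assms(2) by (auto simp: Nabla_def)

text \<open>Two lists related entrywise are connected by changing one entry at a time; each change
  is an instance of \<open>step\<close>, and transitivity joins them. Compatibility can thus be
  checked in a single argument position.\<close>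

lemma Con_translationI:
  assumes alg: "is_algebra ar A"
    and sub: "\<theta> \<subseteq> Nabla A"
    and refl: "\<And>x. x \<in> carrier A \<Longrightarrow> (x, x) \<in> \<theta>"
    and sym: "\<And>x y. (x, y) \<in> \<theta> \<Longrightarrow> (y, x) \<in> \<theta>"
    and trans: "\<And>x y z. (x, y) \<in> \<theta> \<Longrightarrow> (y, z) \<in> \<theta> \<Longrightarrow> (x, z) \<in> \<theta>"
    and step: "\<And>f us x y vs. set us \<subseteq> carrier A \<Longrightarrow> set vs \<subseteq> carrier A \<Longrightarrow> (x, y) \<in> \<theta> \<Longrightarrow>
      Suc (length us + length vs) = ar f \<Longrightarrow>
      (interp A f (us @ x # vs), interp A f (us @ y # vs)) \<in> \<theta>"
  shows "\<theta> \<in> Con ar A"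
proof (rule ConI[OF sub refl sym trans])
  fix f xs ys
  assume len: "length xs = ar f" and rel: "list_all2 (\<lambda>x y. (x, y) \<in> \<theta>) xs ys"
  have leny: "length ys = length xs" using rel by (simp add: list_all2_lengthD)
  have car: "(xs ! i, ys ! i) \<in> \<theta>" "xs ! i \<in> carrier A" "ys ! i \<in> carrier A"
    if "i < length xs" for i
    using that rel sub by (auto simp: list_all2_conv_all_nth Nabla_def)
  have xs: "set xs \<subseteq> carrier A" and ys: "set ys \<subseteq> carrier A"
    using car leny by (auto simp: in_set_conv_nth)
  \<comment> \<open>Hybrid lists: the first \<open>k\<close> entries come from \<open>ys\<close>,
    the rest from \<open>xs\<close>. At \<open>k = length xs\<close> only \<open>ys\<close>
    remains.\<close>
  have "(interp A f xs, interp A f (take k ys @ drop k xs)) \<in> \<theta>" if "k \<le> length xs" for k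
    using that
  proof (induction k)
    case 0
    have "interp A f xs \<in> carrier A" using xs len alg by (simp add: is_algebra_def)
    then show ?case using refl by simp
  next
    case (Suc k)
    have "(interp A f (take k ys @ xs ! k # drop (Suc k) xs),
        interp A f (take k ys @ ys ! k # drop (Suc k) xs)) \<in> \<theta>"
    proof (intro step)
      show "set (take k ys) \<subseteq> carrier A" using set_take_subset ys by (rule subset_trans)
      show "set (drop (Suc k) xs) \<subseteq> carrier A" using set_drop_subset xs by (rule subset_trans)
    qed (use car(1)[of k] Suc.prems leny len in auto)
    moreover have "take k ys @ xs ! k # drop (Suc k) xs = take k ys @ drop k xs"
      using Suc.prems by (simp add: Cons_nth_drop_Suc)
    moreover have "take k ys @ ys ! k # drop (Suc k) xs = take (Suc k) ys @ drop (Suc k) xs"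
      using Suc.prems leny by (simp add: take_Suc_conv_app_nth)
    ultimately show ?case using Suc trans by (metis Suc_leD)
  qed
  from this[of "length xs"] leny show "(interp A f xs, interp A f ys) \<in> \<theta>" by simp
qed auto

lemma Delta_in_Con:
  assumes "is_algebra ar A"
  shows "Delta A \<in> Con ar A"
  by (rule Con_translationI[OF assms]) (use assms in \<open>auto simp: Delta_def Nabla_def is_algebra_def\<close>)

lemma Delta_subset_Con:
  assumes "\<theta> \<in> Con ar A"
  shows "Delta A \<subseteq> \<theta>"
  using Con_refl[OF assms] by (auto simp: Delta_def)

lemma Con_Int:
  assumes a: "\<alpha> \<in> Con ar A" and b: "\<beta> \<in> Con ar A"
  shows "\<alpha> \<inter> \<beta> \<in> Con ar A"
proof (rule ConI)
  show "\<alpha> \<inter> \<beta> \<subseteq> Nabla A" using Con_subset[OF a] by blast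
  show "(x, x) \<in> \<alpha> \<inter> \<beta>" if "x \<in> carrier A" for x
    using that Con_refl[OF a] Con_refl[OF b] by blast
  show "(y, x) \<in> \<alpha> \<inter> \<beta>" if "(x, y) \<in> \<alpha> \<inter> \<beta>" for x y
    using that Con_sym[OF a] Con_sym[OF b] by blast
  show "(x, z) \<in> \<alpha> \<inter> \<beta>" if "(x, y) \<in> \<alpha> \<inter> \<beta>" "(y, z) \<in> \<alpha> \<inter> \<beta>" for x y z
    using that Con_trans[OF a] Con_trans[OF b] by blast
  show "(interp A f xs, interp A f ys) \<in> \<alpha> \<inter> \<beta>"
    if "length xs = ar f" "list_all2 (\<lambda>x y. (x, y) \<in> \<alpha> \<inter> \<beta>) xs ys" for f xs ys
    using that Con_interp[OF a] Con_interp[OF b] by (auto simp: list_all2_conv_all_nth)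
qed

lemma cjoin_least:
  assumes "\<theta> \<in> Con ar A" and "\<alpha> \<subseteq> \<theta>" and "\<beta> \<subseteq> \<theta>"
  shows "cjoin ar A \<alpha> \<beta> \<subseteq> \<theta>"
  using assms by (auto simp: cjoin_def Cg_def)

lemma cjoin_upper: "\<alpha> \<subseteq> cjoin ar A \<alpha> \<beta>" "\<beta> \<subseteq> cjoin ar A \<alpha> \<beta>"
  by (auto simp: cjoin_def Cg_def)

lemma cjoin_absorb:
  assumes "\<alpha> \<in> Con ar A" and "\<beta> \<subseteq> \<alpha>"
  shows "cjoin ar A \<alpha> \<beta> = \<alpha>"
  using assms by (intro antisym cjoin_least cjoin_upper) auto

lemma cjoin_in_Con:
  assumes alg: "is_algebra ar A" and a: "\<alpha> \<in> Con ar A" and b: "\<beta> \<in> Con ar A"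
  shows "cjoin ar A \<alpha> \<beta> \<in> Con ar A"
proof -
  let ?S = "{\<theta> \<in> Con ar A. \<alpha> \<union> \<beta> \<subseteq> \<theta>}"
  \<comment> \<open>Membership of \<open>Nabla A\<close> makes the family non-empty, so its
    intersection is not \<open>UNIV\<close> but a relation on the carrier.\<close>
  have N: "Nabla A \<in> ?S" using Nabla_in_Con[OF alg] Con_subset[OF a] Con_subset[OF b] by simp
  have "\<Inter>?S \<in> Con ar A"
  proof (rule ConI)
    show "\<Inter>?S \<subseteq> Nabla A" using N by blast
    show "(x, x) \<in> \<Inter>?S" if "x \<in> carrier A" for x
      using that by (auto intro: Con_refl)
    show "(y, x) \<in> \<Inter>?S" if "(x, y) \<in> \<Inter>?S" for x y
    proof
      fix \<theta> assume "\<theta> \<in> ?S"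
      then show "(y, x) \<in> \<theta>" using that Con_sym[of \<theta> ar A x y] by blast
    qed
    show "(x, z) \<in> \<Inter>?S" if "(x, y) \<in> \<Inter>?S" "(y, z) \<in> \<Inter>?S" for x y z
    proof
      fix \<theta> assume "\<theta> \<in> ?S"
      then show "(x, z) \<in> \<theta>" using that Con_trans[of \<theta> ar A x y z] by blast
    qed
    show "(interp A f xs, interp A f ys) \<in> \<Inter>?S"
      if "length xs = ar f" "list_all2 (\<lambda>x y. (x, y) \<in> \<Inter>?S) xs ys" for f xs ys
    proof
      fix \<theta> assume t: "\<theta> \<in> ?S"
      have "list_all2 (\<lambda>x y. (x, y) \<in> \<theta>) xs ys"
        by (rule list_all2_mono[OF that(2)]) (use t in blast)
      with t that(1) show "(interp A f xs, interp A f ys) \<in> \<theta>" by (auto intro: Con_interp)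
    qed
  qed
  then show ?thesis by (simp add: cjoin_def Cg_def)
qed

section \<open>Terms, morphisms and models\<close>

lemma eval_trm_closed:
  assumes "is_algebra ar A" and "wf_trm ar t" and "\<And>x. v x \<in> carrier A"
  shows "eval_trm A v t \<in> carrier A"
  using assms(2)
proof (induction t)
  case (App f ts)
  then have "set (map (eval_trm A v) ts) \<subseteq> carrier A" by auto
  with App.prems assms(1) show ?case by (simp add: is_algebra_def)
qed (simp add: assms(3))

lemma Con_eval_trm:
  assumes "\<theta> \<in> Con ar A" and "wf_trm ar t" and "\<And>x. (v x, w x) \<in> \<theta>"
  shows "(eval_trm A v t, eval_trm A w t) \<in> \<theta>"
  using assms(2)
proof (induction t)
  case (App f ts)
  then have "list_all2 (\<lambda>x y. (x, y) \<in> \<theta>) (map (eval_trm A v) ts) (map (eval_trm A w) ts)"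
    by (auto simp: list_all2_conv_all_nth)
  with App.prems show ?case by (auto intro: Con_interp[OF assms(1)])
qed (simp add: assms(3))

primrec subst :: "('v \<Rightarrow> ('f, 'w) trm) \<Rightarrow> ('f, 'v) trm \<Rightarrow> ('f, 'w) trm" where
  "subst \<sigma> (Var x) = \<sigma> x"
| "subst \<sigma> (App f ts) = App f (map (subst \<sigma>) ts)"

lemma eval_trm_subst: "eval_trm A v (subst \<sigma> t) = eval_trm A (\<lambda>x. eval_trm A v (\<sigma> x)) t"
proof (induction t)
  case (App f ts)
  then have "map (eval_trm A v \<circ> subst \<sigma>) ts = map (eval_trm A (\<lambda>x. eval_trm A v (\<sigma> x))) ts" by simp
  then show ?case by (simp del: map_eq_conv)
qed simp

lemma wf_trm_subst:
  assumes "wf_trm ar t" and "\<And>x. wf_trm ar (\<sigma> x)"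
  shows "wf_trm ar (subst \<sigma> t)"
  using assms(1) by (induction t) (auto simp: assms(2))

lemma morphism_carrier:
  assumes "morphism ar A B g" and "x \<in> carrier A"
  shows "g x \<in> carrier B"
  using assms by (auto simp: morphism_def)

lemma morphism_interp:
  assumes "morphism ar A B g" and "set xs \<subseteq> carrier A" and "length xs = ar f"
  shows "g (interp A f xs) = interp B f (map g xs)"
  using assms by (simp add: morphism_def)

lemma morphism_eval_trm:
  assumes "is_algebra ar A" and "morphism ar A B g" and "wf_trm ar t" and "\<And>x. v x \<in> carrier A"
  shows "g (eval_trm A v t) = eval_trm B (\<lambda>x. g (v x)) t"
  using assms(3)
proof (induction t)
  case (App f ts)
  then have "set (map (eval_trm A v) ts) \<subseteq> carrier A"
    using eval_trm_closed[where v = v, OF assms(1) _ assms(4)] by auto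
  then have "g (eval_trm A v (App f ts)) = interp B f (map g (map (eval_trm A v) ts))"
    using App.prems by (simp add: morphism_interp[OF assms(2)])
  also have "map g (map (eval_trm A v) ts) = map (eval_trm B (\<lambda>x. g (v x))) ts"
    using App by simp
  finally show ?case by simp
qed simp

lemma morphism_comp:
  assumes "morphism ar A B g" and "morphism ar B D k"
  shows "morphism ar A D (k \<circ> g)"
  unfolding morphism_def
proof (intro conjI allI impI)
  show "k \<circ> g \<in> carrier A \<rightarrow> carrier D"
    using assms by (auto simp: morphism_def)
  fix f xs assume "set xs \<subseteq> carrier A \<and> length xs = ar f"
  moreover from this have "set (map g xs) \<subseteq> carrier B"
    using morphism_carrier[OF assms(1)] by auto
  ultimately show "(k \<circ> g) (interp A f xs) = interp D f (map (k \<circ> g) xs)"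
    using morphism_interp[OF assms(1), of xs f] morphism_interp[OF assms(2), of "map g xs" f] by simp
qed

lemma subalgebra_morphism_image:
  assumes alg: "is_algebra ar A" and g: "morphism ar A B g"
  shows "subalgebra ar (g ` carrier A) B"
  unfolding subalgebra_def
proof (intro conjI allI impI)
  show "g ` carrier A \<subseteq> carrier B" using morphism_carrier[OF g] by blast
  show "g ` carrier A \<noteq> {}" using alg by (simp add: is_algebra_def)
  fix f ys assume ys: "set ys \<subseteq> g ` carrier A \<and> length ys = ar f"
  then obtain xs where xs: "set xs \<subseteq> carrier A" "ys = map g xs"
  proof -
    have "ys \<in> map g ` lists (carrier A)" using ys by (auto simp: lists_image[symmetric])
    then show thesis using that by auto
  qed
  then have "interp B f ys = g (interp A f xs)"
    using ys morphism_interp[OF g, of xs f] by simp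
  then show "interp B f ys \<in> g ` carrier A" using alg xs ys by (auto simp: is_algebra_def)
qed

lemma pullback_in_Con:
  assumes alg: "is_algebra ar A" and g: "morphism ar A B g" and p: "\<psi> \<in> Con ar B"
  shows "pullback A g \<psi> \<in> Con ar A"
proof (rule ConI)
  show "pullback A g \<psi> \<subseteq> Nabla A" by (auto simp: pullback_def Nabla_def)
  show "(x, x) \<in> pullback A g \<psi>" if "x \<in> carrier A" for x
    using that morphism_carrier[OF g] Con_refl[OF p] by (auto simp: pullback_def)
  show "(y, x) \<in> pullback A g \<psi>" if "(x, y) \<in> pullback A g \<psi>" for x y
    using that Con_sym[OF p] by (auto simp: pullback_def)
  show "(x, z) \<in> pullback A g \<psi>" if "(x, y) \<in> pullback A g \<psi>" "(y, z) \<in> pullback A g \<psi>" for x y z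
    using that Con_trans[OF p] by (auto simp: pullback_def)
  fix f xs ys
  assume len: "length xs = ar f" and rel: "list_all2 (\<lambda>x y. (x, y) \<in> pullback A g \<psi>) xs ys"
  have leny: "length ys = ar f" using rel len by (simp add: list_all2_lengthD)
  have xs: "set xs \<subseteq> carrier A" and ys: "set ys \<subseteq> carrier A"
    using rel by (fastforce simp: list_all2_conv_all_nth in_set_conv_nth pullback_def)+
  have "list_all2 (\<lambda>x y. (x, y) \<in> \<psi>) (map g xs) (map g ys)"
    using rel by (auto simp: list_all2_conv_all_nth pullback_def)
  then have "(interp B f (map g xs), interp B f (map g ys)) \<in> \<psi>"
    using len by (intro Con_interp[OF p]) auto
  then show "(interp A f xs, interp A f ys) \<in> pullback A g \<psi>"
    using alg xs ys len leny morphism_interp[OF g] by (auto simp: pullback_def is_algebra_def)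
qed

text \<open>An assignment into \<open>B\<close> lifts pointwise along the surjection to one into
  \<open>A\<close>; there the identities hold, and \<open>g\<close> carries them back. This will
  place quotients in the class.\<close>

lemma models_surj_image:
  assumes wf: "\<forall>(s, t)\<in>E. wf_trm ar s \<and> wf_trm ar t" and A: "A \<in> models ar E"
    and g: "morphism ar A B g" and surj: "carrier B = g ` carrier A"
  shows "B \<in> models ar E"
proof -
  have alg: "is_algebra ar A" using A by (simp add: models_def)
  have "is_algebra ar B"
    using subalgebra_morphism_image[OF alg g] surj by (auto simp: is_algebra_def subalgebra_def)
  moreover have "eval_trm B v s = eval_trm B v t" if st: "(s, t) \<in> E" and v: "range v \<subseteq> carrier B" for s t v
  proof -
    have "\<forall>x. \<exists>y\<in>carrier A. v x = g y" using v surj by blast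
    then obtain w where w: "\<And>x. w x \<in> carrier A" "\<And>x. v x = g (w x)" by metis
    have "eval_trm A w s = eval_trm A w t"
      using A st w(1) unfolding models_def by fast
    moreover have "v = (\<lambda>x. g (w x))" using w(2) by blast
    ultimately show ?thesis
      using wf st morphism_eval_trm[where v = w, OF alg g _ w(1), of s] morphism_eval_trm[where v = w, OF alg g _ w(1), of t]
      by auto
  qed
  ultimately show ?thesis by (auto simp: models_def)
qed

text \<open>Joint injectivity embeds \<open>D\<close> into the square of \<open>A\<close>, so
  identities may be checked after each of the two morphisms. Closure under subalgebras of squares is
  thereby obtained without forming a product, whose elements would have another type.\<close>

lemma models_jointly_injective:
  assumes wf: "\<forall>(s, t)\<in>E. wf_trm ar s \<and> wf_trm ar t" and A: "A \<in> models ar E" and D: "is_algebra ar D"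
    and g: "morphism ar D A g1" "morphism ar D A g2"
    and inj: "\<And>x y. x \<in> carrier D \<Longrightarrow> y \<in> carrier D \<Longrightarrow> g1 x = g1 y \<Longrightarrow> g2 x = g2 y \<Longrightarrow> x = y"
  shows "D \<in> models ar E"
proof -
  have "eval_trm D v s = eval_trm D v t" if st: "(s, t) \<in> E" and v: "range v \<subseteq> carrier D" for s t v
  proof -
    have v: "v x \<in> carrier D" for x using v by blast
    have wst: "wf_trm ar s" "wf_trm ar t" using wf st by auto
    have eq: "g (eval_trm D v s) = g (eval_trm D v t)" if g: "morphism ar D A g" for g
    proof -
      have "range (\<lambda>x. g (v x)) \<subseteq> carrier A" using morphism_carrier[OF g] v by blast
      then have "eval_trm A (\<lambda>x. g (v x)) s = eval_trm A (\<lambda>x. g (v x)) t"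
        using A st unfolding models_def by fast
      then show ?thesis using morphism_eval_trm[where v = v, OF D g _ v] wst by simp
    qed
    show ?thesis using inj eq g eval_trm_closed[where v = v, OF D _ v] wst by blast
  qed
  then show ?thesis using D by (auto simp: models_def)
qed

section \<open>The commutator in congruence-distributive classes\<close>

text \<open>Modulo \<open>\<alpha>\<close> the left arguments can be exchanged, so the hypothesis on
  \<open>k\<close> is transported to \<open>l\<close>; modulo \<open>\<beta>\<close> the conclusion
  is immediate, since the right arguments are related.\<close>

lemma term_condition_Int:
  fixes ar :: "'f \<Rightarrow> nat"
  assumes a: "\<alpha> \<in> Con ar A" and b: "\<beta> \<in> Con ar A"
  shows "term_condition ar A \<alpha> \<beta> (\<alpha> \<inter> \<beta>)"
  unfolding term_condition_def
proof (intro allI impI)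
  fix t :: "('f, nat + nat) trm" and k l c d
  assume wf: "wf_trm ar t" and rel: "(\<forall>i. (k i, l i) \<in> \<alpha>) \<and> (\<forall>j. (c j, d j) \<in> \<beta>)"
    and hyp: "(eval_trm A (case_sum k c) t, eval_trm A (case_sum k d) t) \<in> \<alpha> \<inter> \<beta>"
  have ra: "(e j, e j) \<in> \<alpha>" if "e = c \<or> e = d" for e j
    using that rel Con_carrier[OF b] by (blast intro: Con_refl[OF a])
  have rb: "(l i, l i) \<in> \<beta>" for i
    using rel Con_carrier[OF a] by (blast intro: Con_refl[OF b])
  have move: "(eval_trm A (case_sum k e) t, eval_trm A (case_sum l e) t) \<in> \<alpha>" if "e = c \<or> e = d" for e
    by (rule Con_eval_trm[OF a wf]) (use rel ra that in \<open>auto split: sum.split\<close>)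
  have "(eval_trm A (case_sum l c) t, eval_trm A (case_sum l d) t) \<in> \<alpha>"
    using move[of c] move[of d] hyp Con_sym[OF a] Con_trans[OF a] by blast
  moreover have "(eval_trm A (case_sum l c) t, eval_trm A (case_sum l d) t) \<in> \<beta>"
    by (rule Con_eval_trm[OF b wf]) (use rel rb in \<open>auto split: sum.split\<close>)
  ultimately show "(eval_trm A (case_sum l c) t, eval_trm A (case_sum l d) t) \<in> \<alpha> \<inter> \<beta>" by blast
qed

text \<open>The largest congruence for which \<open>U\<close> is a union of classes: the syntactic congruence of \<open>U\<close>.
  Unary polynomials are terms in which all left variables are substituted by the argument.\<close>

definition syntactic_congruence ::
    "('f \<Rightarrow> nat) \<Rightarrow> ('f, 'u) algebra \<Rightarrow> 'u set \<Rightarrow> ('u \<times> 'u) set" where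
  "syntactic_congruence ar A U = {(z, w) \<in> carrier A \<times> carrier A.
     \<forall>(t :: ('f, nat + nat) trm) e. wf_trm ar t \<and> (\<forall>j. e j \<in> carrier A) \<longrightarrow>
       (eval_trm A (case_sum (\<lambda>_. z) e) t \<in> U \<longleftrightarrow> eval_trm A (case_sum (\<lambda>_. w) e) t \<in> U)}"

lemma syntactic_congruenceD:
  fixes t :: "('f, nat + nat) trm"
  assumes "(z, w) \<in> syntactic_congruence ar A U" and "wf_trm ar t" and "\<And>j. e j \<in> carrier A"
  shows "eval_trm A (case_sum (\<lambda>_. z) e) t \<in> U \<longleftrightarrow> eval_trm A (case_sum (\<lambda>_. w) e) t \<in> U"
  using assms unfolding syntactic_congruence_def by simp

lemma syntactic_congruenceI:
  fixes ar :: "'f \<Rightarrow> nat"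
  assumes "z \<in> carrier A" and "w \<in> carrier A"
    and "\<And>(t :: ('f, nat + nat) trm) e. wf_trm ar t \<Longrightarrow> \<forall>j. e j \<in> carrier A \<Longrightarrow>
      eval_trm A (case_sum (\<lambda>_. z) e) t \<in> U \<longleftrightarrow> eval_trm A (case_sum (\<lambda>_. w) e) t \<in> U"
  shows "(z, w) \<in> syntactic_congruence ar A U"
  using assms unfolding syntactic_congruence_def by simp

lemma syntactic_congruence_saturates:
  assumes "is_algebra ar A" and "(z, w) \<in> syntactic_congruence ar A U"
  shows "z \<in> U \<longleftrightarrow> w \<in> U"
proof -
  \<comment> \<open>The identity polynomial \<open>Var (Inl 0)\<close> is the test; \<open>x\<close>
    is a dummy value for all parameters.\<close>
  obtain x where "x \<in> carrier A" using assms(1) by (auto simp: is_algebra_def)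
  then show ?thesis
    using syntactic_congruenceD[OF assms(2), of "Var (Inl 0)" "\<lambda>_. x"] by simp
qed

text \<open>A unary polynomial composed with the basic translation that puts \<open>z\<close>
  between \<open>us\<close> and \<open>vs\<close> is again a unary polynomial. Hence a test
  separating the translates of \<open>x\<close> and \<open>y\<close> would yield one separating
  \<open>x\<close> and \<open>y\<close>.\<close>

lemma syntactic_congruence_in_Con:
  assumes alg: "is_algebra ar A"
  shows "syntactic_congruence ar A U \<in> Con ar A"
proof (rule Con_translationI[OF alg])
  fix f us x y vs
  assume us: "set us \<subseteq> carrier A" and vs: "set vs \<subseteq> carrier A"
    and xy: "(x, y) \<in> syntactic_congruence ar A U" and len: "Suc (length us + length vs) = ar f"
  have xyc: "x \<in> carrier A" "y \<in> carrier A" using xy by (auto simp: syntactic_congruence_def)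
  define k where "k = length us"
  have closed: "interp A f (us @ z # vs) \<in> carrier A" if "z \<in> carrier A" for z
    using us vs that len alg by (auto simp: is_algebra_def)
  have "eval_trm A (case_sum (\<lambda>_. interp A f (us @ x # vs)) e) t \<in> U \<longleftrightarrow>
      eval_trm A (case_sum (\<lambda>_. interp A f (us @ y # vs)) e) t \<in> U"
    if wf: "wf_trm ar t" and e: "\<forall>j. e j \<in> carrier A" for t :: "('a, nat + nat) trm" and e
  proof -
    \<comment> \<open>The basic translation as a term: the argument sits at position
      \<open>k\<close>, and every other position \<open>i\<close> holds the parameter
      \<open>Inr i\<close>.\<close>
    define r :: "('a, nat + nat) trm"
      where "r = App f (map (\<lambda>i. Var (if i = k then Inl 0 else Inr i)) [0..<ar f])"
    \<comment> \<open>The parameters of \<open>t\<close> are shifted by \<open>ar f\<close> to keep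
      them apart from those of \<open>r\<close>.\<close>
    define s where "s = subst (case_sum (\<lambda>_. r) (\<lambda>j. Var (Inr (j + ar f)))) t"
    \<comment> \<open>The first \<open>ar f\<close> parameters are the fixed list entries, followed
      by the old parameters \<open>e\<close>. The value \<open>x\<close> at position
      \<open>k\<close> is a placeholder, since \<open>r\<close> has its argument there.\<close>
    define e' where "e' j = (if j < ar f then (us @ x # vs) ! j else e (j - ar f))" for j
    have nth: "(if i = k then z else e' i) = (us @ z # vs) ! i" if "i < ar f" for i z
      using that by (auto simp: e'_def k_def nth_append nth_Cons split: nat.split)
    have "wf_trm ar s"
      unfolding s_def by (rule wf_trm_subst[OF wf]) (auto simp: r_def split: sum.split)
    moreover have "e' j \<in> carrier A" for j
    proof (cases "j < ar f")
      case True
      then have "(us @ x # vs) ! j \<in> set (us @ x # vs)" using len by (intro nth_mem) simp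
      with True us vs xyc show ?thesis by (auto simp: e'_def)
    qed (use e in \<open>simp add: e'_def\<close>)
    moreover have "eval_trm A (case_sum (\<lambda>_. z) e') s =
        eval_trm A (case_sum (\<lambda>_. interp A f (us @ z # vs)) e) t" for z
    proof -
      have "map (\<lambda>i. if i = k then z else e' i) [0..<ar f] = us @ z # vs"
      proof (rule nth_equalityI)
        fix i assume "i < length (map (\<lambda>i. if i = k then z else e' i) [0..<ar f])"
        then show "map (\<lambda>i. if i = k then z else e' i) [0..<ar f] ! i = (us @ z # vs) ! i"
          using nth[of i z] by (simp only: length_map length_upt nth_map nth_upt diff_zero add_0_left)
      qed (use len in simp)
      moreover have "map (eval_trm A (case_sum (\<lambda>_. z) e'))
          (map (\<lambda>i. Var (if i = k then Inl (0::nat) else Inr i)) [0..<ar f]) =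
          map (\<lambda>i. if i = k then z else e' i) [0..<ar f]"
        by simp
      ultimately have r: "eval_trm A (case_sum (\<lambda>_. z) e') r = interp A f (us @ z # vs)"
        by (simp only: r_def eval_trm.simps)
      have "(\<lambda>v::nat + nat. eval_trm A (case_sum (\<lambda>_. z) e') (case_sum (\<lambda>_. r) (\<lambda>j. Var (Inr (j + ar f))) v)) =
          case_sum (\<lambda>_. interp A f (us @ z # vs)) e"
        by (auto simp: fun_eq_iff r e'_def split: sum.split)
      then show ?thesis
        unfolding s_def eval_trm_subst by (rule arg_cong[where f = "\<lambda>v. eval_trm A v t"])
    qed
    ultimately show ?thesis using syntactic_congruenceD[OF xy, of s e'] by simp
  qed
  then show "(interp A f (us @ x # vs), interp A f (us @ y # vs)) \<in> syntactic_congruence ar A U"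
    using closed xyc by (auto simp: syntactic_congruence_def)
qed (auto simp: syntactic_congruence_def Nabla_def)

text \<open>Here \<open>D\<close> is any copy of the subalgebra \<open>\<beta>\<close> of the square
  of \<open>A\<close>: \<open>inj\<close> and \<open>image\<close> identify its elements with the
  pairs in \<open>\<beta>\<close>, and \<open>p\<close> and \<open>q\<close> are the projections.
  The freedom in choosing \<open>D\<close> allows a copy inside the universe.\<close>

lemma Int_subset_of_term_condition:
  assumes A: "is_algebra ar A" and D: "is_algebra ar D" and dist: "Con_distributive ar D"
    and a: "\<alpha> \<in> Con ar A" and b: "\<beta> \<in> Con ar A" and tc: "term_condition ar A \<alpha> \<beta> \<delta>"
    and d: "\<delta> \<in> Con ar A"
    and p: "morphism ar D A p" and q: "morphism ar D A q"
    and inj: "\<And>x y. x \<in> carrier D \<Longrightarrow> y \<in> carrier D \<Longrightarrow> p x = p y \<Longrightarrow> q x = q y \<Longrightarrow> x = y"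
    and image: "(\<lambda>z. (p z, q z)) ` carrier D = \<beta>"
  shows "\<alpha> \<inter> \<beta> \<subseteq> \<delta>"
proof (rule subrelI)
  fix x y assume "(x, y) \<in> \<alpha> \<inter> \<beta>"
  then have xya: "(x, y) \<in> \<alpha>" and xyb: "(x, y) \<in> \<beta>" by auto
  have xy: "x \<in> carrier A" "y \<in> carrier A" using Con_carrier[OF a xya] by auto
  have "(x, x) \<in> \<beta>" "(y, y) \<in> \<beta>" using xy Con_refl[OF b] by auto
  \<comment> \<open>The elements of \<open>D\<close> that represent the pairs \<open>(x, x)\<close>,
    \<open>(x, y)\<close> and \<open>(y, y)\<close>.\<close>
  then obtain xx' xy' yy' where D': "xx' \<in> carrier D" "xy' \<in> carrier D" "yy' \<in> carrier D"
    and proj: "p xx' = x" "q xx' = x" "p xy' = x" "q xy' = y" "p yy' = y" "q yy' = y"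
    using xyb unfolding image[symmetric] by auto
  \<comment> \<open>\<open>U\<close> is \<open>\<beta> \<inter> \<delta>\<close> seen inside
    \<open>D\<close>; below, \<open>\<eta> g\<close> is the kernel of \<open>g\<close>.\<close>
  define U where "U = {z \<in> carrier D. (p z, q z) \<in> \<delta>}"
  define \<Theta> where "\<Theta> = syntactic_congruence ar D U"
  define \<eta> where "\<eta> g = pullback D g (Delta A)" for g
  have T: "\<Theta> \<in> Con ar D" unfolding \<Theta>_def by (rule syntactic_congruence_in_Con[OF D])
  have ep: "\<eta> p \<in> Con ar D" and eq: "\<eta> q \<in> Con ar D"
    unfolding \<eta>_def using pullback_in_Con[OF D _ Delta_in_Con[OF A]] p q by blast+
  \<comment> \<open>This is the term condition read in \<open>D\<close>: for diagonal
    \<open>w\<close> the value of \<open>t\<close> lies in \<open>U\<close> iff \<open>t\<close> at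
    \<open>p w\<close> sends the \<open>\<beta>\<close>-related parameter tuples
    \<open>p (e j)\<close> and \<open>q (e j)\<close> to \<open>\<delta>\<close>-related elements,
    and \<open>p w\<close> may be replaced by \<open>p w'\<close>.\<close>
  have half: "eval_trm D (case_sum (\<lambda>_. w') e) t \<in> U"
    if "w \<in> carrier D" "w' \<in> carrier D" "p w = q w" "p w' = q w'" "(p w, p w') \<in> \<alpha>"
      "wf_trm ar t" "\<forall>j. e j \<in> carrier D" "eval_trm D (case_sum (\<lambda>_. w) e) t \<in> U"
    for w w' e and t :: "('a, nat + nat) trm"
  proof -
    have ev: "g (eval_trm D (case_sum (\<lambda>_. u) e) t) = eval_trm A (case_sum (\<lambda>_. g u) (\<lambda>j. g (e j))) t"
      if "morphism ar D A g" "u \<in> carrier D" for g u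
    proof -
      have "g (eval_trm D (case_sum (\<lambda>_. u) e) t) = eval_trm A (\<lambda>x. g (case_sum (\<lambda>_. u) e x)) t"
        by (rule morphism_eval_trm[OF D that(1) \<open>wf_trm ar t\<close>])
          (use that(2) \<open>\<forall>j. e j \<in> carrier D\<close> in \<open>auto split: sum.split\<close>)
      also have "(\<lambda>x::nat + nat. g (case_sum (\<lambda>_. u) e x)) = case_sum (\<lambda>_. g u) (\<lambda>j. g (e j))"
        by (auto simp: fun_eq_iff split: sum.split)
      finally show ?thesis .
    qed
    have pq: "\<forall>j. (p (e j), q (e j)) \<in> \<beta>" using that(7) image by blast
    have "(eval_trm A (case_sum (\<lambda>_. p w) (\<lambda>j. p (e j))) t,
        eval_trm A (case_sum (\<lambda>_. p w) (\<lambda>j. q (e j))) t) \<in> \<delta>"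
      using that(8) ev[OF p that(1)] ev[OF q that(1)] that(3) by (simp add: U_def)
    then have "(eval_trm A (case_sum (\<lambda>_. p w') (\<lambda>j. p (e j))) t,
        eval_trm A (case_sum (\<lambda>_. p w') (\<lambda>j. q (e j))) t) \<in> \<delta>"
      by (rule tc[unfolded term_condition_def, rule_format, rotated 2]) (use that(5,6) pq in auto)
    moreover have "eval_trm D (case_sum (\<lambda>_. w') e) t \<in> carrier D"
      using that(2,7) by (intro eval_trm_closed[OF D that(6)]) (auto split: sum.split)
    ultimately show ?thesis using ev[OF p that(2)] ev[OF q that(2)] that(4) by (simp add: U_def)
  qed
  \<comment> \<open>Symmetry supplies the converse implication, with the two diagonal elements
    exchanged in \<open>half\<close>.\<close>
  have yxa: "(y, x) \<in> \<alpha>" using Con_sym[OF a xya] .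
  have "(xx', yy') \<in> \<Theta>"
    unfolding \<Theta>_def
  proof (rule syntactic_congruenceI)
    fix t :: "('a, nat + nat) trm" and e :: "nat \<Rightarrow> _"
    assume te: "wf_trm ar t" "\<forall>j. e j \<in> carrier D"
    have "(p xx', p yy') \<in> \<alpha>" "(p yy', p xx') \<in> \<alpha>" "p xx' = q xx'" "p yy' = q yy'"
      using proj xya yxa by auto
    with D' show "eval_trm D (case_sum (\<lambda>_. xx') e) t \<in> U \<longleftrightarrow> eval_trm D (case_sum (\<lambda>_. yy') e) t \<in> U"
      using half[OF _ _ _ _ _ te] by blast
  qed (use D' in auto)
  then have "(xx', yy') \<in> cjoin ar D (\<eta> q) \<Theta>" using cjoin_upper by blast
  moreover have "(yy', xy') \<in> \<eta> q" using D' proj xy by (auto simp: \<eta>_def pullback_def Delta_def)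
  then have "(yy', xy') \<in> cjoin ar D (\<eta> q) \<Theta>" using cjoin_upper by blast
  ultimately have "(xx', xy') \<in> cjoin ar D (\<eta> q) \<Theta>"
    using Con_trans[OF cjoin_in_Con[OF D eq T]] by blast
  moreover have "(xx', xy') \<in> \<eta> p" using D' proj xy by (auto simp: \<eta>_def pullback_def Delta_def)
  ultimately have "(xx', xy') \<in> cjoin ar D (\<eta> p \<inter> \<eta> q) (\<eta> p \<inter> \<Theta>)"
    using dist ep eq T unfolding Con_distributive_def by blast
  \<comment> \<open>The two kernels meet trivially, so after distributing only the part below
    \<open>\<Theta>\<close> remains.\<close>
  moreover have "\<eta> p \<inter> \<eta> q \<subseteq> Delta D"
    using inj by (auto simp: \<eta>_def pullback_def Delta_def)
  then have "cjoin ar D (\<eta> p \<inter> \<eta> q) (\<eta> p \<inter> \<Theta>) \<subseteq> \<Theta>"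
    using Delta_subset_Con[OF T] by (intro cjoin_least[OF T]) auto
  ultimately have "(xx', xy') \<in> \<Theta>" by blast
  \<comment> \<open>\<open>xx'\<close> lies in \<open>U\<close> by reflexivity of
    \<open>\<delta>\<close>, and membership of \<open>xy'\<close> in \<open>U\<close> is the
    claim.\<close>
  then have "xx' \<in> U \<longleftrightarrow> xy' \<in> U"
    unfolding \<Theta>_def by (rule syntactic_congruence_saturates[OF D])
  then show "(x, y) \<in> \<delta>" using D' proj Con_refl[OF d xy(1)] by (simp add: U_def)
qed

section \<open>Copies of congruences inside the universe\<close>

text \<open>The countably many variables embed into \<open>'u\<close>, so \<open>'u\<close> is
  infinite, and an infinite set has the same cardinality as its square.\<close>

lemma inj_pairing_of_inj_trm:
  assumes "inj (g :: ('f, nat) trm \<Rightarrow> 'u)"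
  shows "\<exists>p :: 'u \<times> 'u \<Rightarrow> 'u. inj p"
proof -
  have "inj (\<lambda>n. g (Var n))" using assms by (auto simp: inj_def)
  then have "infinite (UNIV :: 'u set)"
    using infinite_UNIV_nat finite_imageD[of "\<lambda>n. g (Var n)" UNIV] finite_subset[OF subset_UNIV] by blast
  then have "(card_of (UNIV \<times> UNIV :: ('u \<times> 'u) set), card_of (UNIV :: 'u set)) \<in> ordLeq"
    using card_of_Times_same_infinite[of "UNIV :: 'u set"] ordIso_iff_ordLeq by blast
  then obtain p :: "'u \<times> 'u \<Rightarrow> 'u" where "inj_on p (UNIV \<times> UNIV)"
    unfolding card_of_ordLeq[symmetric] by blast
  then show ?thesis by auto
qed

text \<open>The subalgebra \<open>\<beta>\<close> of the square of \<open>A\<close>, coded by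
  \<open>p\<close> on the type \<open>'u\<close> so that it can belong to the same class as
  \<open>A\<close>; \<open>inv p\<close> decodes.\<close>

definition congruence_algebra ::
    "('f, 'u) algebra \<Rightarrow> ('u \<times> 'u \<Rightarrow> 'u) \<Rightarrow> ('u \<times> 'u) set \<Rightarrow> ('f, 'u) algebra" where
  "congruence_algebra A p \<beta> = \<lparr>carrier = p ` \<beta>,
     interp = (\<lambda>f xs. p (interp A f (map (fst \<circ> inv p) xs), interp A f (map (snd \<circ> inv p) xs)))\<rparr>"

text \<open>Closure of \<open>\<beta>\<close> under the coordinatewise operations is precisely its
  compatibility; after decoding, the projections commute with the operations by
  construction.\<close>

lemma congruence_algebra:
  assumes p: "inj p" and A: "is_algebra ar A" and b: "\<beta> \<in> Con ar A"
  shows "is_algebra ar (congruence_algebra A p \<beta>)"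
    and "morphism ar (congruence_algebra A p \<beta>) A (fst \<circ> inv p)"
    and "morphism ar (congruence_algebra A p \<beta>) A (snd \<circ> inv p)"
proof -
  show "is_algebra ar (congruence_algebra A p \<beta>)"
    unfolding is_algebra_def
  proof (intro conjI allI impI)
    obtain x where "x \<in> carrier A" using A by (auto simp: is_algebra_def)
    then show "carrier (congruence_algebra A p \<beta>) \<noteq> {}"
      using Con_refl[OF b] by (auto simp: congruence_algebra_def)
    fix f xs
    assume xs: "set xs \<subseteq> carrier (congruence_algebra A p \<beta>) \<and> length xs = ar f"
    then have "\<forall>x\<in>set xs. (fst (inv p x), snd (inv p x)) \<in> \<beta>"
      using p by (auto simp: congruence_algebra_def)
    then have "list_all2 (\<lambda>x y. (x, y) \<in> \<beta>) (map (fst \<circ> inv p) xs) (map (snd \<circ> inv p) xs)"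
      by (simp add: list_all2_conv_all_nth)
    then show "interp (congruence_algebra A p \<beta>) f xs \<in> carrier (congruence_algebra A p \<beta>)"
      using xs by (auto simp: congruence_algebra_def intro!: Con_interp[OF b])
  qed
  show "morphism ar (congruence_algebra A p \<beta>) A (fst \<circ> inv p)"
    "morphism ar (congruence_algebra A p \<beta>) A (snd \<circ> inv p)"
    using p Con_carrier[OF b] by (auto simp: morphism_def congruence_algebra_def)
qed

text \<open>One inclusion holds because the intersection satisfies the term condition. For the
  other, \<open>\<delta>\<close> is taken to be the commutator itself, and distributivity is applied
  to the coded algebra on \<open>\<beta>\<close>, which is a member of \<open>C\<close>.\<close>

lemma congruence_distributive_commutator:
  fixes C :: "('f, 'u) algebra set"
  assumes "\<exists>g :: ('f, nat) trm \<Rightarrow> 'u. inj g" and "equational_class ar C"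
    and dist: "congruence_distributive ar C" and M: "M \<in> C"
  shows "commutator_is_inter ar M"
  unfolding commutator_is_inter_def
proof (intro ballI antisym)
  obtain E where wf: "\<forall>(s, t)\<in>E. wf_trm ar s \<and> wf_trm ar t" and C: "C = models ar E"
    using assms(2) by (auto simp: equational_class_def)
  have alg: "is_algebra ar M" using M by (simp add: C models_def)
  obtain p :: "'u \<times> 'u \<Rightarrow> 'u" where p: "inj p" using assms(1) inj_pairing_of_inj_trm by blast
  fix \<alpha> \<beta> assume a: "\<alpha> \<in> Con ar M" and b: "\<beta> \<in> Con ar M"
  show "commutator ar M \<alpha> \<beta> \<subseteq> \<alpha> \<inter> \<beta>"
    by (rule commutator_least(3)[OF alg a b Con_Int[OF a b] term_condition_Int[OF a b]])
  let ?D = "congruence_algebra M p \<beta>"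
  note D = congruence_algebra[OF p alg b]
  have inj: "x = y" if "x \<in> carrier ?D" "y \<in> carrier ?D" "(fst \<circ> inv p) x = (fst \<circ> inv p) y"
      "(snd \<circ> inv p) x = (snd \<circ> inv p) y" for x y
    using that p by (auto simp: congruence_algebra_def)
  have "?D \<in> C"
    unfolding C by (rule models_jointly_injective[OF wf M[unfolded C] D inj])
  then have "Con_distributive ar ?D" using dist by (simp add: congruence_distributive_def)
  moreover have "(\<lambda>z. ((fst \<circ> inv p) z, (snd \<circ> inv p) z)) ` carrier ?D = \<beta>"
    using p by (force simp: congruence_algebra_def image_image)
  ultimately show "\<alpha> \<inter> \<beta> \<subseteq> commutator ar M \<alpha> \<beta>"
    using Int_subset_of_term_condition[OF alg D(1) _ a b commutator_least(2)[OF alg a b]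
        commutator_least(1)[OF alg a b] D(2,3) inj] by blast
qed

section \<open>Maximal congruences\<close>

text \<open>If \<open>\<phi>\<close> is prime and lies below a proper \<open>\<theta>\<close>, then
  \<open>\<phi>\<close> contains \<open>\<theta>\<close> or its complement; the latter would lie
  below \<open>\<theta>\<close> and force \<open>\<theta>\<close> to be \<open>Nabla M\<close>.
  Conversely, if \<open>\<mu>\<close> is maximal and \<open>\<beta>\<close> is not below it, their
  join is \<open>Nabla M\<close>, and distributing \<open>\<alpha>\<close> over this join puts
  \<open>\<alpha>\<close> below \<open>\<mu>\<close> whenever
  \<open>\<alpha> \<inter> \<beta>\<close> is.\<close>

lemma Spec_eq_Max_Con_if_Boolean:
  assumes alg: "is_algebra ar M" and comm: "commutator_is_inter ar M" and bool: "Con_Boolean ar M"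
  shows "Spec ar M = Max_Con ar M"
proof (intro set_eqI iffI)
  have comm: "commutator ar M \<alpha> \<beta> = \<alpha> \<inter> \<beta>" if "\<alpha> \<in> Con ar M" "\<beta> \<in> Con ar M" for \<alpha> \<beta>
    using comm that by (simp add: commutator_is_inter_def)
  {
    fix \<phi> assume p: "\<phi> \<in> Spec ar M"
    have "\<theta> = \<phi>" if t: "\<theta> \<in> Con ar M" "\<theta> \<noteq> Nabla M" "\<phi> \<subseteq> \<theta>" for \<theta>
    proof -
      obtain \<theta>' where t': "\<theta>' \<in> Con ar M" "\<theta> \<inter> \<theta>' = Delta M" "cjoin ar M \<theta> \<theta>' = Nabla M"
        using bool t(1) by (auto simp: Con_Boolean_def)
      have "commutator ar M \<theta> \<theta>' \<subseteq> \<phi>"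
        using comm[OF t(1) t'(1)] t'(2) Delta_subset_Con[of \<phi> ar M] p by (simp add: Spec_def)
      then have "\<theta> \<subseteq> \<phi> \<or> \<theta>' \<subseteq> \<phi>" using p t(1) t'(1) by (auto simp: Spec_def)
      moreover have "\<not> \<theta>' \<subseteq> \<phi>"
        using cjoin_absorb[OF t(1), of \<theta>'] t t'(3) by auto
      ultimately show ?thesis using t(3) by blast
    qed
    then show "\<phi> \<in> Max_Con ar M" using p by (auto simp: Max_Con_def Spec_def)
  next
    fix \<mu> assume m: "\<mu> \<in> Max_Con ar M"
    then have mc: "\<mu> \<in> Con ar M" "\<mu> \<noteq> Nabla M" by (auto simp: Max_Con_def)
    have join: "cjoin ar M \<mu> \<alpha> = Nabla M" if "\<alpha> \<in> Con ar M" "\<not> \<alpha> \<subseteq> \<mu>" for \<alpha>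
      using m cjoin_in_Con[OF alg mc(1) that(1)] cjoin_upper[of \<mu> ar M \<alpha>] cjoin_upper(2)[of \<alpha> ar M \<mu>] that
      unfolding Max_Con_def by blast
    have "\<alpha> \<subseteq> \<mu>" if ab: "\<alpha> \<in> Con ar M" "\<beta> \<in> Con ar M" "\<alpha> \<inter> \<beta> \<subseteq> \<mu>" "\<not> \<beta> \<subseteq> \<mu>" for \<alpha> \<beta>
    proof -
      have "\<alpha> = \<alpha> \<inter> cjoin ar M \<mu> \<beta>"
        using join[OF ab(2,4)] Con_subset[OF ab(1)] by blast
      also have "\<dots> = cjoin ar M (\<alpha> \<inter> \<mu>) (\<alpha> \<inter> \<beta>)"
        using bool ab mc by (simp add: Con_Boolean_def Con_distributive_def)
      also have "\<dots> \<subseteq> \<mu>" using ab by (intro cjoin_least mc(1)) auto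
      finally show ?thesis .
    qed
    then show "\<mu> \<in> Spec ar M" using mc comm by (auto simp: Spec_def)
  }
qed

section \<open>Congruences with two classes and their pullbacks\<close>

lemma Con2_related:
  assumes p: "\<psi> \<in> Con2 ar N" and N: "x \<in> carrier N" "y \<in> carrier N" "z \<in> carrier N"
    and xy: "(x, y) \<notin> \<psi>"
  shows "(x, z) \<in> \<psi> \<or> (y, z) \<in> \<psi>"
proof (rule ccontr)
  assume contr: "\<not> ((x, z) \<in> \<psi> \<or> (y, z) \<in> \<psi>)"
  have e: "equiv (carrier N) \<psi>" and c: "card (carrier N // \<psi>) = 2"
    using p by (auto simp: Con2_def Con_def)
  have "\<psi> `` {x} \<noteq> \<psi> `` {y}" "\<psi> `` {x} \<noteq> \<psi> `` {z}" "\<psi> `` {y} \<noteq> \<psi> `` {z}"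
    using contr xy N eq_equiv_class[OF _ e] by blast+
  then have "card {\<psi> `` {x}, \<psi> `` {y}, \<psi> `` {z}} = 3" by simp
  moreover have "{\<psi> `` {x}, \<psi> `` {y}, \<psi> `` {z}} \<subseteq> carrier N // \<psi>"
    using N by (auto intro: quotientI)
  \<comment> \<open>Infinite sets have \<open>card\<close> 0, so a quotient of cardinality 2 is
    finite.\<close>
  moreover have "finite (carrier N // \<psi>)" using c by (auto intro: card_ge_0_finite)
  ultimately show False using c card_mono[of "carrier N // \<psi>" "{\<psi> `` {x}, \<psi> `` {y}, \<psi> `` {z}}"] by simp
qed

lemma Con2_neq_Nabla:
  assumes "\<psi> \<in> Con2 ar N"
  shows "\<psi> \<noteq> Nabla N"
proof
  assume "\<psi> = Nabla N"
  then have "carrier N // \<psi> \<subseteq> {carrier N}" by (auto simp: quotient_def Nabla_def)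
  then have "card (carrier N // \<psi>) \<le> card {carrier N}" by (intro card_mono) auto
  then show False using assms by (simp add: Con2_def)
qed

text \<open>A strictly larger \<open>\<theta>\<close> relates some \<open>a\<close> and
  \<open>b\<close> that lie over different classes of \<open>\<psi>\<close>. Every element lies over
  one of these two classes, so \<open>\<theta>\<close> relates it to \<open>a\<close> and is
  \<open>Nabla M\<close>.\<close>

lemma pullback_Con2_maximal:
  assumes alg: "is_algebra ar M" and h: "morphism ar M N h"
    and p: "\<psi> \<in> Con2 ar N" and neq: "pullback M h \<psi> \<noteq> Nabla M"
  shows "pullback M h \<psi> \<in> Max_Con ar M"
proof -
  have pc: "\<psi> \<in> Con ar N" using p by (simp add: Con2_def)
  have "\<theta> = pullback M h \<psi>"
    if t: "\<theta> \<in> Con ar M" "\<theta> \<noteq> Nabla M" and sub: "pullback M h \<psi> \<subseteq> \<theta>" for \<theta>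
  proof (rule ccontr)
    assume "\<theta> \<noteq> pullback M h \<psi>"
    then obtain a b where ab: "(a, b) \<in> \<theta>" "(a, b) \<notin> pullback M h \<psi>" using sub by auto
    have abM: "a \<in> carrier M" "b \<in> carrier M" using Con_carrier[OF t(1) ab(1)] by auto
    then have "(h a, h b) \<notin> \<psi>" using ab(2) by (auto simp: pullback_def)
    then have "(h a, h c) \<in> \<psi> \<or> (h b, h c) \<in> \<psi>" if "c \<in> carrier M" for c
      using that abM morphism_carrier[OF h] by (intro Con2_related[OF p]) auto
    then have "(a, c) \<in> pullback M h \<psi> \<or> (b, c) \<in> pullback M h \<psi>" if "c \<in> carrier M" for c
      using that abM by (auto simp: pullback_def)
    then have ac: "(a, c) \<in> \<theta>" if "c \<in> carrier M" for c
      using that sub ab(1) Con_trans[OF t(1)] by blast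
    have "Nabla M \<subseteq> \<theta>"
      using Con_trans[OF t(1) Con_sym[OF t(1) ac] ac] by (auto simp: Nabla_def)
    then show False using t Con_subset[OF t(1)] by blast
  qed
  then show ?thesis
    using pullback_in_Con[OF alg h pc] neq by (auto simp: Max_Con_def)
qed

text \<open>The quotient \<open>N/\<psi>\<close> is realised on a system of representatives, so that it lies in the universe.\<close>

lemma semi_degenerate_pullback_neq_Nabla:
  fixes C :: "('f, 'u) algebra set"
  assumes C: "equational_class ar C" and sd: "semi_degenerate ar C"
    and M: "is_algebra ar M" and N: "N \<in> C" and h: "morphism ar M N h"
    and p: "\<psi> \<in> Con ar N" and neq: "\<psi> \<noteq> Nabla N"
  shows "pullback M h \<psi> \<noteq> Nabla M"
proof
  assume nab: "pullback M h \<psi> = Nabla M"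
  obtain E where wf: "\<forall>(s, t)\<in>E. wf_trm ar s \<and> wf_trm ar t" and CE: "C = models ar E"
    using C by (auto simp: equational_class_def)
  have alg: "is_algebra ar N" using N by (simp add: CE models_def)
  define r where "r x = (SOME y. (x, y) \<in> \<psi>)" for x
  have r: "(x, r x) \<in> \<psi>" if "x \<in> carrier N" for x
    unfolding r_def using Con_refl[OF p that] by (rule someI)
  \<comment> \<open>Related elements admit the same candidates, so \<open>SOME\<close> picks one
    representative for the whole class.\<close>
  have rI: "r x = r y" if "(x, y) \<in> \<psi>" for x y
  proof -
    have "(x, z) \<in> \<psi> \<longleftrightarrow> (y, z) \<in> \<psi>" for z using that Con_sym[OF p] Con_trans[OF p] by blast
    then show ?thesis by (simp add: r_def)
  qed
  define Q where "Q = \<lparr>carrier = r ` carrier N, interp = (\<lambda>f xs. r (interp N f xs))\<rparr>"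
  have mor: "morphism ar N Q r"
    unfolding morphism_def
  proof (intro conjI allI impI)
    fix f xs assume xs: "set xs \<subseteq> carrier N \<and> length xs = ar f"
    then have "list_all2 (\<lambda>x y. (x, y) \<in> \<psi>) xs (map r xs)"
      using r by (force simp: list_all2_conv_all_nth)
    then show "r (interp N f xs) = interp Q f (map r xs)"
      using xs by (auto simp: Q_def intro!: rI Con_interp[OF p])
  qed (auto simp: Q_def)
  have "Q \<in> C"
    unfolding CE by (rule models_surj_image[OF wf N[unfolded CE] mor]) (simp add: Q_def)
  moreover have "subalgebra ar ((r \<circ> h) ` carrier M) Q"
    by (rule subalgebra_morphism_image[OF M morphism_comp[OF h mor]])
  \<comment> \<open>A pullback equal to \<open>Nabla M\<close> means that \<open>h\<close> maps
    \<open>M\<close> into a single class of \<open>\<psi>\<close>.\<close>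
  moreover have "is_singleton ((r \<circ> h) ` carrier M)"
  proof -
    obtain m where m: "m \<in> carrier M" using M by (auto simp: is_algebra_def)
    have "(h x, h m) \<in> \<psi>" if "x \<in> carrier M" for x
      using nab m that by (auto simp: pullback_def Nabla_def)
    then have "(r \<circ> h) ` carrier M = {r (h m)}" using m rI by fastforce
    then show ?thesis by (simp add: is_singleton_def)
  qed
  \<comment> \<open>Semi-degeneracy now makes \<open>Q\<close> trivial, so \<open>\<psi>\<close> has
    only one class, contrary to \<open>neq\<close>.\<close>
  ultimately have "is_singleton (carrier Q)" using sd unfolding semi_degenerate_def by blast
  then obtain c where "r ` carrier N = {c}" by (auto simp: Q_def is_singleton_def)
  then have "r x = r y" if "x \<in> carrier N" "y \<in> carrier N" for x y
    using that by (metis imageI singletonD)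
  then have "(x, y) \<in> \<psi>" if "x \<in> carrier N" "y \<in> carrier N" for x y
    using that r Con_sym[OF p] Con_trans[OF p] by metis
  then have "Nabla N \<subseteq> \<psi>" by (auto simp: Nabla_def)
  then show False using neq Con_subset[OF p] by blast
qed

text \<open>The common core of all six statements, which differ only in how they provide
  \<open>specM\<close> and \<open>neq\<close>.\<close>

lemma admissible_going_up_if_pullback_neq_Nabla:
  assumes alg: "is_algebra ar M" and h: "morphism ar M N h"
    and specM: "Spec ar M = Max_Con ar M" and specN: "Spec ar N = Con2 ar N"
    and neq: "\<And>\<psi>. \<psi> \<in> Con ar N \<Longrightarrow> \<psi> \<noteq> Nabla N \<Longrightarrow> pullback M h \<psi> \<noteq> Nabla M"
  shows "admissible ar M N h \<and> going_up ar M N h"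
proof
  show "admissible ar M N h"
    unfolding admissible_def specM specN
  proof
    fix \<psi> assume p: "\<psi> \<in> Con2 ar N"
    then have "pullback M h \<psi> \<noteq> Nabla M"
      using Con2_neq_Nabla[OF p] by (intro neq) (auto simp: Con2_def)
    then show "pullback M h \<psi> \<in> Max_Con ar M" by (rule pullback_Con2_maximal[OF alg h p])
  qed
  \<comment> \<open>Since distinct maximal congruences are incomparable, the given prime of
    \<open>N\<close> itself serves as the witness for Going Up.\<close>
  have "\<psi> = \<phi>" if "\<phi> \<in> Max_Con ar M" "\<psi> \<in> Max_Con ar M" "\<phi> \<subseteq> \<psi>" for \<phi> \<psi>
    using that by (auto simp: Max_Con_def)
  then show "going_up ar M N h" unfolding going_up_def specM by blast
qed

theorem proposition5p2:
  fixes ar :: "'f \<Rightarrow> nat"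
    and C :: "('f, 'u) algebra set"
    and M N :: "('f, 'u) algebra"
    and h :: "'u \<Rightarrow> 'u"
  assumes "\<exists>g :: ('f, nat) trm \<Rightarrow> 'u. inj g"
    and "equational_class ar C"
    and "congruence_modular ar C"
    and "M \<in> C" and "N \<in> C"
    and "morphism ar M N h"
  shows
    "(semi_degenerate ar C \<and>
        Spec ar M = Max_Con ar M \<and> Spec ar N = Con2 ar N
        \<longrightarrow> admissible ar M N h \<and> going_up ar M N h)
   \<and> (semi_degenerate ar C \<and>
        commutator_is_inter ar M \<and> Con_Boolean ar M \<and> Spec ar N = Con2 ar N
        \<longrightarrow> admissible ar M N h \<and> going_up ar M N h)
   \<and> (semi_degenerate ar C \<and> congruence_distributive ar C \<and>
        Con_Boolean ar M \<and> Spec ar N = Con2 ar N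
        \<longrightarrow> admissible ar M N h \<and> going_up ar M N h)
   \<and> ({\<psi> \<in> Con ar N. pullback M h \<psi> = Nabla M} = {Nabla N} \<and>
        Spec ar M = Max_Con ar M \<and> Spec ar N = Con2 ar N
        \<longrightarrow> admissible ar M N h \<and> going_up ar M N h)
   \<and> ({\<psi> \<in> Con ar N. pullback M h \<psi> = Nabla M} = {Nabla N} \<and>
        commutator_is_inter ar M \<and> Con_Boolean ar M \<and> Spec ar N = Con2 ar N
        \<longrightarrow> admissible ar M N h \<and> going_up ar M N h)
   \<and> ({\<psi> \<in> Con ar N. pullback M h \<psi> = Nabla M} = {Nabla N} \<and>
        congruence_distributive ar C \<and> Con_Boolean ar M \<and> Spec ar N = Con2 ar N
        \<longrightarrow> admissible ar M N h \<and> going_up ar M N h)"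
proof -
  obtain E where CE: "C = models ar E" using assms(2) by (auto simp: equational_class_def)
  have alg: "is_algebra ar M" using assms(4) by (simp add: CE models_def)
  note main = admissible_going_up_if_pullback_neq_Nabla[OF alg assms(6)]
  \<comment> \<open>Properness of pullbacks has two sources: semi-degeneracy here, and in
    \<open>pre\<close> the assumption that only \<open>Nabla N\<close> pulls back to
    \<open>Nabla M\<close>.\<close>
  have sd: "pullback M h \<psi> \<noteq> Nabla M"
    if "semi_degenerate ar C" "\<psi> \<in> Con ar N" "\<psi> \<noteq> Nabla N" for \<psi>
    by (rule semi_degenerate_pullback_neq_Nabla[OF assms(2) that(1) alg assms(5,6) that(2,3)])
  have pre: "pullback M h \<psi> \<noteq> Nabla M"
    if "{\<psi> \<in> Con ar N. pullback M h \<psi> = Nabla M} = {Nabla N}" "\<psi> \<in> Con ar N" "\<psi> \<noteq> Nabla N" for \<psi>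
    using that by blast
  note bool = Spec_eq_Max_Con_if_Boolean[OF alg]
  \<comment> \<open>For a congruence-distributive class this supplies the commutator hypothesis of
    \<open>bool\<close>.\<close>
  note cd = congruence_distributive_commutator[OF assms(1,2) _ assms(4)]
  show ?thesis
  proof (intro conjI; rule impI; elim conjE)
    assume sem: "semi_degenerate ar C" and N: "Spec ar N = Con2 ar N"
    note main = main[OF _ N sd[OF sem]]
    show "admissible ar M N h \<and> going_up ar M N h" if "Spec ar M = Max_Con ar M"
      by (rule main) (rule that)
    show "admissible ar M N h \<and> going_up ar M N h" if "commutator_is_inter ar M" "Con_Boolean ar M"
      by (rule main) (rule bool[OF that])
    show "admissible ar M N h \<and> going_up ar M N h" if "congruence_distributive ar C" "Con_Boolean ar M"
      by (rule main) (rule bool[OF cd[OF that(1)] that(2)])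
  next
    assume nab: "{\<psi> \<in> Con ar N. pullback M h \<psi> = Nabla M} = {Nabla N}"
      and N: "Spec ar N = Con2 ar N"
    note main = main[OF _ N pre[OF nab]]
    show "admissible ar M N h \<and> going_up ar M N h" if "Spec ar M = Max_Con ar M"
      by (rule main) (rule that)
    show "admissible ar M N h \<and> going_up ar M N h" if "commutator_is_inter ar M" "Con_Boolean ar M"
      by (rule main) (rule bool[OF that])
    show "admissible ar M N h \<and> going_up ar M N h" if "congruence_distributive ar C" "Con_Boolean ar M"
      by (rule main) (rule bool[OF cd[OF that(1)] that(2)])
  qed
qed

end
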